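(* Let $h(t)=\sum_{i=0}^{d} h_i t^i$ be a polynomial of degree $d$ with nonnegative integer coefficients that is palindromic, i.e. $h_i=h_{d-i}$ for every $0\le i\le d$. If the $\gamma$-vector $\gamma(h)=(\gamma_0,\gamma_1,\ldots,\gamma_{\lfloor d/2\rfloor})$ of $h(t)$ is an $O$-sequence, then the $g$-vector $g(h)=(g_0,g_1,\ldots,g_{\lfloor d/2\rfloor})$ of $h(t)$ is a pure $O$-sequence.
   Context: The $\gamma$-vector: a palindromic polynomial $h(t)=\sum_{i=0}^d h_it^i$ of degree $d$ has a unique expression $h(t)=\sum_{j=0}^{\lfloor d/2\rfloor}\gamma_j\,t^j(1+t)^{d-2j}$, and $\gamma(h)=(\gamma_0,\gamma_1,\ldots,\gamma_{\lfloor d/2\rfloor})$. The $g$-vector: $g(h)=(g_0,\ldots,g_{\lfloor d/2\rfloor})$ is defined by $g_0=h_0$ and $g_i=h_i-h_{i-1}$ for $1\le i\le\lfloor d/2\rfloor$. A multicomplex is a finite nonempty set $M$ of monomials (in finitely many commuting variables) such that whenever $u\in M$ and $v$ divides $u$, then $v\in M$. For $i\ge 0$, $f_i(M)$ denotes the number of monomials of degree $i$ in $M$. A multicomplex is pure if all its maximal monomials (with respect to divisibility) have the same degree. A sequence $(a_0,a_1,\ldots,a_s)$ is an $O$-sequence if there is a multicomplex $M$ with $f_i(M)=a_i$ for $0\le i\le s$ and $f_i(M)=0$ for $i>s$; it is a pure $O$-sequence if such an $M$ can be chosen to be pure. *)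

theory Defs
  imports "HOL-Library.Multiset" "HOL-Computational_Algebra.Polynomial"
begin

definition palindromic :: "int poly \<Rightarrow> bool" where
  "palindromic h \<longleftrightarrow> (\<forall>i \<le> degree h. coeff h i = coeff h (degree h - i))"

text \<open>A vector \<open>(a\<^sub>0, \<dots>, a\<^sub>s)\<close> is the list of its \<open>s + 1\<close> entries.\<close>

definition gamma_expansion :: "nat \<Rightarrow> int list \<Rightarrow> int poly" where
  "gamma_expansion d \<gamma> =
     (\<Sum>j = 0..d div 2. smult (\<gamma> ! j) (monom 1 j * [:1, 1:] ^ (d - 2 * j)))"

text \<open>The description is proper for palindromic \<open>h\<close>, see \<open>ex1_gamma_expansion\<close> below.\<close>

definition gamma_vector :: "int poly \<Rightarrow> int list" where
  "gamma_vector h =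
     (THE \<gamma>. length \<gamma> = degree h div 2 + 1 \<and> h = gamma_expansion (degree h) \<gamma>)"

definition g_vector :: "int poly \<Rightarrow> int list" where
  "g_vector h =
     map (\<lambda>i. if i = 0 then coeff h 0 else coeff h i - coeff h (i - 1)) [0..<degree h div 2 + 1]"

text \<open>
  A monomial in the variables \<open>x\<^sub>0, x\<^sub>1, \<dots>\<close> is the multiset of the indices of its variables:
  divisibility is \<open>\<subseteq>#\<close> and the degree is \<^const>\<open>size\<close>. A finite set of monomials
  involves only finitely many of the variables.
\<close>

type_synonym monomial = "nat multiset"

definition multicomplex :: "monomial set \<Rightarrow> bool" where
  "multicomplex M \<longleftrightarrow>
     finite M \<and> M \<noteq> {} \<and> (\<forall>u \<in> M. \<forall>v. v \<subseteq># u \<longrightarrow> v \<in> M)"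

definition f_number :: "nat \<Rightarrow> monomial set \<Rightarrow> nat" where
  "f_number i M = card {u \<in> M. size u = i}"

definition maximal_monomial :: "monomial set \<Rightarrow> monomial \<Rightarrow> bool" where
  "maximal_monomial M u \<longleftrightarrow> u \<in> M \<and> (\<forall>v \<in> M. u \<subseteq># v \<longrightarrow> v = u)"

definition pure_multicomplex :: "monomial set \<Rightarrow> bool" where
  "pure_multicomplex M \<longleftrightarrow> multicomplex M \<and>
     (\<forall>u v. maximal_monomial M u \<longrightarrow> maximal_monomial M v \<longrightarrow> size u = size v)"

definition is_f_vector :: "int list \<Rightarrow> monomial set \<Rightarrow> bool" where
  "is_f_vector a M \<longleftrightarrow>
     (\<forall>i < length a. int (f_number i M) = a ! i) \<and> (\<forall>i \<ge> length a. f_number i M = 0)"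

definition O_sequence :: "int list \<Rightarrow> bool" where
  "O_sequence a \<longleftrightarrow> (\<exists>M. multicomplex M \<and> is_f_vector a M)"

definition pure_O_sequence :: "int list \<Rightarrow> bool" where
  "pure_O_sequence a \<longleftrightarrow> (\<exists>M. pure_multicomplex M \<and> is_f_vector a M)"

lemma gamma_expansion_Cons:
  assumes "2 \<le> n"
  shows "gamma_expansion n (c # \<gamma>) = smult c ([:1, 1:] ^ n) + pCons 0 (gamma_expansion (n - 2) \<gamma>)"
proof -
  obtain m where n: "n = Suc (Suc m)" using assms by (metis Suc_le_D numeral_2_eq_2 Suc_le_mono)
  have X: "pCons 0 p = monom 1 (Suc 0) * p" for p :: "int poly"
    by (simp add: monom_Suc)
  show ?thesis
    unfolding gamma_expansion_def n X
    by (simp add: sum.atLeast0_atMost_Suc_shift sum_distrib_left mult.assoc[symmetric] mult_monom del: sum.cl_ivl_Suc power_Suc)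
qed

lemma coeff_0_add_power: "coeff ([:1, 1:] ^ n :: int poly) 0 = 1"
  by (simp add: coeff_0_power)

lemma ex1_gamma_expansion_aux:
  fixes h :: "int poly"
  assumes "degree h \<le> n" "\<And>i. i \<le> n \<Longrightarrow> coeff h i = coeff h (n - i)"
  shows "\<exists>!\<gamma>. length \<gamma> = n div 2 + 1 \<and> h = gamma_expansion n \<gamma>"
  using assms
proof (induction n arbitrary: h rule: less_induct)
  case (less n)
  show ?case
  proof (cases "n < 2")
    case True
    have h: "h = smult (coeff h 0) ([:1, 1:] ^ n)"
    proof (cases "n = 0")
      case True
      then show ?thesis using less.prems(1) by (auto elim!: degree_eq_zeroE)
    next
      case False
      then have n: "n = 1" using True by simp
      have "coeff h 1 = coeff h 0" using less.prems(2)[of 0] n by simp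
      moreover have "coeff h i = 0" if "i > 1" for i
        using that less.prems(1) n by (intro coeff_eq_0) simp
      ultimately show ?thesis
        by (auto simp: n poly_eq_iff coeff_pCons split: nat.splits)
    qed
    have E: "gamma_expansion n \<gamma> = smult (\<gamma> ! 0) ([:1, 1:] ^ n)" for \<gamma>
      using True by (simp add: gamma_expansion_def)
    have len: "length \<gamma> = n div 2 + 1 \<longleftrightarrow> (\<exists>c. \<gamma> = [c])" for \<gamma> :: "int list"
      using True by (auto simp: length_Suc_conv)
    show ?thesis
    proof (rule ex1I[of _ "[coeff h 0]"])
      show "length [coeff h 0] = n div 2 + 1 \<and> h = gamma_expansion n [coeff h 0]"
        using h True by (simp add: E)
    next
      fix \<gamma> assume *: "length \<gamma> = n div 2 + 1 \<and> h = gamma_expansion n \<gamma>"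
      then obtain c where c: "\<gamma> = [c]" using len by blast
      with * have "h = smult c ([:1, 1:] ^ n)" by (simp add: E)
      then show "\<gamma> = [coeff h 0]" using c by (simp add: coeff_0_add_power)
    qed
  next
    case False
    then have n2: "2 \<le> n" by simp
    define r where "r = h - smult (coeff h 0) ([:1, 1:] ^ n)"
    obtain b q where bq: "r = pCons b q" by (cases r)
    have "coeff r 0 = 0" by (simp add: r_def coeff_0_add_power)
    then have b: "b = 0" using bq by simp
    have q: "coeff q i = coeff r (Suc i)" for i by (simp add: bq)
    have P: "coeff ([:1, 1:] ^ n :: int poly) i = of_nat (n choose i)" for i
      by (cases "i \<le> n") (auto simp: coeff_linear_poly_power coeff_eq_0 degree_linear_power)
    have rsym: "coeff r i = coeff r (n - i)" if "i \<le> n" for i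
      using less.prems(2)[OF that] that binomial_symmetric[OF that] by (simp add: r_def P)
    have rn: "coeff r n = 0" using rsym[of n] \<open>coeff r 0 = 0\<close> by simp
    have rbig: "coeff r i = 0" if "i \<ge> n" for i
    proof (cases "i = n")
      case False
      with that have "i > n" by simp
      then show ?thesis using less.prems(1) by (simp add: r_def P coeff_eq_0)
    qed (simp add: rn)
    have dq: "degree q \<le> n - 2" by (intro degree_le) (use n2 in \<open>auto simp: q intro!: rbig\<close>)
    have qsym: "coeff q i = coeff q (n - 2 - i)" if "i \<le> n - 2" for i
    proof -
      have "n - Suc i = Suc (n - 2 - i)" using that n2 by simp
      then show ?thesis using rsym[of "Suc i"] that n2 by (simp add: q)
    qed
    have "n - 2 < n" using n2 by simp
    from less.IH[OF this dq qsym]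
    obtain \<gamma> where \<gamma>: "length \<gamma> = (n - 2) div 2 + 1" "q = gamma_expansion (n - 2) \<gamma>"
      and uniq: "\<And>\<gamma>'. length \<gamma>' = (n - 2) div 2 + 1 \<Longrightarrow> q = gamma_expansion (n - 2) \<gamma>' \<Longrightarrow> \<gamma>' = \<gamma>"
      by blast
    have nd: "n div 2 = Suc ((n - 2) div 2)" using n2 by (simp add: le_div_geq)
    have hq: "h = smult (coeff h 0) ([:1, 1:] ^ n) + pCons 0 q" using bq b by (simp add: r_def)
    show ?thesis
    proof (rule ex1I[of _ "coeff h 0 # \<gamma>"])
      show "length (coeff h 0 # \<gamma>) = n div 2 + 1 \<and> h = gamma_expansion n (coeff h 0 # \<gamma>)"
        using \<gamma> hq nd by (simp add: gamma_expansion_Cons[OF n2])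
    next
      fix \<delta> assume *: "length \<delta> = n div 2 + 1 \<and> h = gamma_expansion n \<delta>"
      then obtain c \<gamma>' where \<delta>: "\<delta> = c # \<gamma>'" by (cases \<delta>) auto
      with * have h': "h = smult c ([:1, 1:] ^ n) + pCons 0 (gamma_expansion (n - 2) \<gamma>')"
        by (simp add: gamma_expansion_Cons[OF n2])
      then have c: "c = coeff h 0" by (simp add: coeff_0_add_power)
      have "pCons 0 q = pCons 0 (gamma_expansion (n - 2) \<gamma>')"
        using h' hq c by (metis add_left_cancel)
      then have "\<gamma>' = \<gamma>" using * \<delta> nd by (intro uniq) auto
      then show "\<delta> = coeff h 0 # \<gamma>" using \<delta> c by simp
    qed
  qed
qed

lemma ex1_gamma_expansion:
  assumes "palindromic h"
  shows "\<exists>!\<gamma>. length \<gamma> = degree h div 2 + 1 \<and> h = gamma_expansion (degree h) \<gamma>"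
  using assms unfolding palindromic_def by (intro ex1_gamma_expansion_aux) blast+

end

theory Submission
  imports Defs
begin

text \<open>
  The difference \<open>(n choose k) - (n choose (k - 1))\<close> with \<open>2 k \<le> n\<close> counts the \<open>k\<close>-subsets \<open>S\<close> of
  \<open>{1..n}\<close> such that every initial segment \<open>{1..m}\<close> has at most \<open>m / 2\<close> elements in \<open>S\<close>. These ballot
  sets form a simplicial complex that grows with \<open>n\<close> and all of whose facets have \<open>\<lfloor>n / 2\<rfloor>\<close> elements.
  If \<open>M\<close> is a multicomplex with \<open>f\<close>-vector \<open>\<gamma>(h)\<close>, then the pairs of a monomial \<open>u \<in> M\<close> of degree \<open>j\<close>
  and a ballot set of \<open>{1..d - 2 j}\<close>, read as monomials in two disjoint sets of variables, form a
  multicomplex with \<open>f\<close>-vector \<open>g(h)\<close>. It is pure, because the second component of a pair of total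
  degree below \<open>\<lfloor>d / 2\<rfloor>\<close> can be enlarged.
\<close>

section \<open>Ballot sets: subset closure, enumeration, extension\<close>

definition ballot_sets :: "nat \<Rightarrow> nat set set" where
  "ballot_sets n = {S. S \<subseteq> {1..n} \<and> (\<forall>m. 2 * card (S \<inter> {..m}) \<le> m)}"

lemma ballot_sets_finite: "S \<in> ballot_sets n \<Longrightarrow> finite S"
  by (auto simp: ballot_sets_def intro: finite_subset)

lemma finite_ballot_sets: "finite (ballot_sets n)"
  by (rule finite_subset[of _ "Pow {1..n}"]) (auto simp: ballot_sets_def)

lemma empty_in_ballot_sets: "{} \<in> ballot_sets n"
  by (simp add: ballot_sets_def)

lemma ballot_sets_subset:
  assumes "S \<in> ballot_sets n" "T \<subseteq> S" "n \<le> n'"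
  shows "T \<in> ballot_sets n'"
proof -
  have "2 * card (T \<inter> {..m}) \<le> m" for m
  proof -
    have "card (T \<inter> {..m}) \<le> card (S \<inter> {..m})"
      using assms ballot_sets_finite[OF assms(1)] by (intro card_mono) auto
    also have "2 * card (S \<inter> {..m}) \<le> m" using assms(1) by (simp add: ballot_sets_def)
    finally show ?thesis by simp
  qed
  moreover have "T \<subseteq> {1..n'}" using assms by (fastforce simp: ballot_sets_def)
  ultimately show ?thesis by (simp add: ballot_sets_def)
qed

lemma ballot_sets_card_le:
  assumes "S \<in> ballot_sets n"
  shows "2 * card S \<le> n"
proof -
  have "S \<inter> {..n} = S" using assms by (auto simp: ballot_sets_def)
  then show ?thesis using assms unfolding ballot_sets_def by (metis (lifting) mem_Collect_eq)
qed

text \<open>The sets are split by whether they contain \<open>Suc n\<close>. Inserting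
  \<open>Suc n\<close> affects only prefixes \<open>{..m}\<close> with m > n, where the size bound
  in the assumption already yields the ballot condition.\<close>

lemma ballot_sets_Suc:
  assumes "2 * Suc k \<le> Suc n"
  shows "{S \<in> ballot_sets (Suc n). card S = Suc k} =
    {S \<in> ballot_sets n. card S = Suc k} \<union> insert (Suc n) ` {S \<in> ballot_sets n. card S = k}"
    (is "?L = ?A \<union> ?B")
proof (intro equalityI subsetI)
  fix S assume S: "S \<in> ?L"
  have fin: "finite S" using S ballot_sets_finite by blast
  show "S \<in> ?A \<union> ?B"
  proof (cases "Suc n \<in> S")
    case True
    define T where "T = S - {Suc n}"
    have "T \<in> ballot_sets (Suc n)" using S ballot_sets_subset[of S _ T] by (auto simp: T_def)
    moreover have "T \<subseteq> {1..n}" using S by (auto simp: T_def ballot_sets_def le_Suc_eq)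
    \<comment> \<open>The prefix condition ranges over all m, so only the inclusion in
      \<open>{1..n}\<close> depends on n.\<close>
    ultimately have "T \<in> ballot_sets n" by (simp add: ballot_sets_def)
    moreover have "card T = k" using S True fin by (simp add: T_def)
    moreover have "S = insert (Suc n) T" using True by (auto simp: T_def)
    ultimately show ?thesis by blast
  next
    case False
    then have "S \<subseteq> {1..n}" using S by (auto simp: ballot_sets_def subset_iff le_Suc_eq)
    then show ?thesis using S by (auto simp: ballot_sets_def)
  qed
next
  fix S assume "S \<in> ?A \<union> ?B"
  then consider "S \<in> ?A" | T where "S = insert (Suc n) T" "T \<in> ballot_sets n" "card T = k"
    by blast
  then show "S \<in> ?L"
  proof cases
    case 1
    then show ?thesis using ballot_sets_subset[of S n S "Suc n"] by auto
  next
    case 2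
    have fin: "finite T" using 2 ballot_sets_finite by blast
    have T: "T \<subseteq> {1..n}" "\<And>m. 2 * card (T \<inter> {..m}) \<le> m" using 2 by (auto simp: ballot_sets_def)
    have "Suc n \<notin> T" using T(1) by auto
    then have card: "card S = Suc k" using 2 fin by simp
    have "2 * card (S \<inter> {..m}) \<le> m" for m
    proof (cases "m \<le> n")
      case True
      then have "S \<inter> {..m} = T \<inter> {..m}" using 2 by auto
      then show ?thesis using T(2) by simp
    next
      case False
      have "card (S \<inter> {..m}) \<le> card S" using fin 2 by (intro card_mono) auto
      then show ?thesis using False assms card by simp
    qed
    moreover have "S \<subseteq> {1..Suc n}" using T(1) 2 by auto
    ultimately show ?thesis using card by (simp add: ballot_sets_def)
  qed
qed

text \<open>Induction by Pascal's rule for both binomials. The bound reaches 2 k = n + 1 because the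
  step to size 2 k calls the case of size 2 k - 1.\<close>

lemma card_ballot_sets:
  assumes "2 * k \<le> Suc n"
  shows "int (card {S \<in> ballot_sets n. card S = k}) =
    int (n choose k) - (if k = 0 then 0 else int (n choose (k - 1)))"
  using assms
proof (induction n arbitrary: k)
  case 0
  have "{S \<in> ballot_sets 0. card S = 0} = {{}}" by (auto simp: ballot_sets_def)
  moreover have "k = 0" using 0 by simp
  ultimately show ?case by simp
next
  case (Suc n)
  show ?case
  proof (cases k)
    case 0
    have "{S \<in> ballot_sets (Suc n). card S = 0} = {{}}"
      using empty_in_ballot_sets ballot_sets_finite by auto
    then show ?thesis using 0 by simp
  next
    case (Suc l)
    show ?thesis
    proof (cases "2 * k \<le> Suc n")
      case True
      have disj: "{S \<in> ballot_sets n. card S = Suc l} \<inter>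
          insert (Suc n) ` {S \<in> ballot_sets n. card S = l} = {}"
        by (auto simp: ballot_sets_def)
      have inj: "inj_on (insert (Suc n)) {S \<in> ballot_sets n. card S = l}"
      proof (rule inj_onI)
        fix S T
        assume "S \<in> {S \<in> ballot_sets n. card S = l}" "T \<in> {S \<in> ballot_sets n. card S = l}"
          and eq: "insert (Suc n) S = insert (Suc n) T"
        then have "Suc n \<notin> S" "Suc n \<notin> T" by (auto simp: ballot_sets_def)
        then show "S = T" using eq by (metis insert_ident)
      qed
      have "card {S \<in> ballot_sets (Suc n). card S = k} =
          card {S \<in> ballot_sets n. card S = Suc l} + card {S \<in> ballot_sets n. card S = l}"
        using True finite_ballot_sets[of n] unfolding Suc
        by (subst ballot_sets_Suc) (simp_all add: card_Un_disjoint disj card_image inj)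
      moreover have "int (card {S \<in> ballot_sets n. card S = Suc l}) =
          int (n choose Suc l) - int (n choose l)"
        using Suc.IH[of "Suc l"] True Suc by simp
      moreover have "int (card {S \<in> ballot_sets n. card S = l}) =
          int (n choose l) - (if l = 0 then 0 else int (n choose (l - 1)))"
        using Suc.IH[of l] True Suc by simp
      ultimately show ?thesis using Suc by (cases l) auto
    next
      \<comment> \<open>Boundary case: no ballot set is this large, and the two middle binomials of
        the odd number \<open>Suc n\<close> agree, so both sides are 0.\<close>
      case False
      then have n: "Suc n = 2 * l + 1" using Suc Suc.prems by simp
      have "{S \<in> ballot_sets (Suc n). card S = k} = {}"
        using ballot_sets_card_le[of _ "Suc n"] False by auto
      moreover have "Suc n choose Suc l = Suc n choose l"
        using binomial_symmetric[of l "Suc n"] n by simp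
      ultimately show ?thesis unfolding Suc by (simp del: Collect_empty_eq binomial_Suc_Suc)
    qed
  qed
qed

lemma ballot_sets_extend:
  assumes "S \<in> ballot_sets n" "2 * Suc (card S) \<le> n"
  shows "\<exists>x. x \<notin> S \<and> insert x S \<in> ballot_sets n"
proof -
  have fin: "finite S" using assms(1) ballot_sets_finite by blast
  have S: "S \<subseteq> {1..n}" "\<And>m. 2 * card (S \<inter> {..m}) \<le> m"
    using assms(1) by (auto simp: ballot_sets_def)
  have "{1..n} - S \<noteq> {}"
  proof
    assume "{1..n} - S = {}"
    then have "card {1..n} \<le> card S" using fin by (intro card_mono) auto
    then show False using assms(2) by simp
  qed
  \<comment> \<open>Every number after the last gap of \<open>S\<close> lies in \<open>S\<close>, so the ballot condition is far from tight there.\<close>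
  define x where "x = Max ({1..n} - S)"
  have x: "x \<in> {1..n} - S" unfolding x_def
    using \<open>{1..n} - S \<noteq> {}\<close> by (intro Max_in) auto
  have above: "y \<in> S" if "x < y" "y \<le> n" for y
  proof (rule ccontr)
    assume "y \<notin> S"
    then have "y \<le> x" unfolding x_def using that by (intro Max_ge) auto
    then show False using that by simp
  qed
  have "2 * card (insert x S \<inter> {..m}) \<le> m" for m
  proof -
    consider "m < x" | "n \<le> m" | "x \<le> m" "m < n" by linarith
    then show ?thesis
    proof cases
      case 1
      then have "insert x S \<inter> {..m} = S \<inter> {..m}" by auto
      then show ?thesis using S(2) by simp
    next
      case 2
      have "card (insert x S \<inter> {..m}) \<le> card (insert x S)" using fin by (intro card_mono) auto
      then show ?thesis using 2 assms(2) x fin by simp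
    next
      case 3
      \<comment> \<open>As S contains all of m + 1, ..., n, the prefix has card S - (n - m)
        elements; with x its doubled size is at most n - 2 (n - m), hence at most m.\<close>
      have "S = (S \<inter> {..m}) \<union> {Suc m..n}" using S(1) above 3 by fastforce
      then have "card S = card ((S \<inter> {..m}) \<union> {Suc m..n})" by (rule arg_cong)
      also have "\<dots> = card (S \<inter> {..m}) + (n - m)"
        using fin by (subst card_Un_disjoint) auto
      finally have "card S = card (S \<inter> {..m}) + (n - m)" .
      moreover have "insert x S \<inter> {..m} = insert x (S \<inter> {..m})" using 3 by auto
      then have "card (insert x S \<inter> {..m}) = Suc (card (S \<inter> {..m}))" using x fin by simp
      moreover obtain e where "n = m + e" using 3 by (metis less_imp_add_positive)
      ultimately show ?thesis using assms(2) by simp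
    qed
  qed
  moreover have "insert x S \<subseteq> {1..n}" using S(1) x by auto
  ultimately show ?thesis using x by (auto simp: ballot_sets_def)
qed

section \<open>Encoding pairs of a monomial and a set\<close>

text \<open>Parity realizes two disjoint sets of variables inside \<open>nat\<close>, and S becomes
  a squarefree monomial. Halving recovers both parts; S must be finite, since
  \<open>mset_set\<close> sends every infinite set to the empty multiset.\<close>

definition interleave :: "monomial \<Rightarrow> nat set \<Rightarrow> monomial" where
  "interleave u S = image_mset (\<lambda>i. 2 * i) u + image_mset (\<lambda>i. Suc (2 * i)) (mset_set S)"

lemma size_interleave: "size (interleave u S) = size u + card S"
  by (simp add: interleave_def)

lemma halve_even_interleave:
  "image_mset (\<lambda>i. i div 2) (filter_mset even (interleave u S)) = u"
  by (simp add: interleave_def filter_mset_image_mset multiset.map_comp o_def)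

lemma halve_odd_interleave:
  "image_mset (\<lambda>i. i div 2) (filter_mset odd (interleave u S)) = mset_set S"
  by (simp add: interleave_def filter_mset_image_mset multiset.map_comp o_def)

lemma interleave_inject:
  assumes "finite S" "finite T" "interleave u S = interleave v T"
  shows "u = v \<and> S = T"
proof
  show "u = v" using assms(3) by (metis halve_even_interleave)
  have "mset_set S = mset_set T" using assms(3) by (metis halve_odd_interleave)
  then show "S = T" using assms(1,2) by (simp add: mset_set_eq_iff)
qed

lemma subset_interleaveE:
  assumes "w \<subseteq># interleave u S" "finite S"
  obtains v T where "v \<subseteq># u" "T \<subseteq> S" "w = interleave v T"
proof -
  define A where "A = image_mset (\<lambda>i. i div 2) (filter_mset even w)"
  define B where "B = image_mset (\<lambda>i. i div 2) (filter_mset odd w)"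
  have A: "A \<subseteq># u"
    using image_mset_subseteq_mono[OF multiset_filter_mono[OF assms(1)], of "\<lambda>i. i div 2" even]
    unfolding A_def halve_even_interleave .
  have B: "B \<subseteq># mset_set S"
    using image_mset_subseteq_mono[OF multiset_filter_mono[OF assms(1)], of "\<lambda>i. i div 2" odd]
    unfolding B_def halve_odd_interleave .
  \<comment> \<open>A divisor of a squarefree monomial is squarefree, hence determined by its
    support.\<close>
  have "mset_set (set_mset B) = B"
  proof (rule multiset_eqI)
    fix i
    have "count B i \<le> count (mset_set S) i" using B by (rule mset_subset_eq_count)
    also have "\<dots> \<le> 1" using assms(2) by (simp add: count_mset_set')
    finally show "count (mset_set (set_mset B)) i = count B i"
      by (cases "count B i") (simp_all add: count_mset_set' flip: count_greater_zero_iff)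
  qed
  moreover have "image_mset (\<lambda>i. 2 * i) A = filter_mset even w"
  proof -
    have "image_mset (\<lambda>i. 2 * i) A = image_mset (\<lambda>i. 2 * (i div 2)) (filter_mset even w)"
      by (simp add: A_def multiset.map_comp o_def)
    also have "\<dots> = image_mset (\<lambda>i. i) (filter_mset even w)"
      by (intro image_mset_cong) simp
    finally show ?thesis by simp
  qed
  moreover have "image_mset (\<lambda>i. Suc (2 * i)) B = filter_mset odd w"
  proof -
    have "image_mset (\<lambda>i. Suc (2 * i)) B = image_mset (\<lambda>i. Suc (2 * (i div 2))) (filter_mset odd w)"
      by (simp add: B_def multiset.map_comp o_def)
    also have "\<dots> = image_mset (\<lambda>i. i) (filter_mset odd w)"
      by (intro image_mset_cong) simp
    finally show ?thesis by simp
  qed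
  ultimately have "w = interleave A (set_mset B)"
    by (simp add: interleave_def)
  moreover have "set_mset B \<subseteq> S" using set_mset_mono[OF B] assms(2) by simp
  ultimately show ?thesis using A that by blast
qed

section \<open>The multicomplex, its purity and its f-vector\<close>

text \<open>A monomial of degree j is paired with ballot sets of \<open>{1..d - 2 * j}\<close> to
  match the summand t^j (1 + t)^(d - 2 j) of the \<gamma>-expansion.\<close>

definition ballot_join :: "nat \<Rightarrow> monomial set \<Rightarrow> monomial set" where
  "ballot_join d M = (\<Union>u \<in> M. interleave u ` ballot_sets (d - 2 * size u))"

lemma multicomplex_ballot_join:
  assumes "multicomplex M"
  shows "multicomplex (ballot_join d M)"
  unfolding multicomplex_def
proof (intro conjI ballI allI impI)
  show "finite (ballot_join d M)"
    using assms finite_ballot_sets by (auto simp: ballot_join_def multicomplex_def)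
  show "ballot_join d M \<noteq> {}"
    using assms empty_in_ballot_sets by (fastforce simp: ballot_join_def multicomplex_def)
next
  fix w w' assume "w \<in> ballot_join d M" and w': "w' \<subseteq># w"
  then obtain u S where u: "u \<in> M" and S: "S \<in> ballot_sets (d - 2 * size u)"
    and w: "w = interleave u S"
    by (auto simp: ballot_join_def)
  obtain v T where v: "v \<subseteq># u" and T: "T \<subseteq> S" "w' = interleave v T"
    using w' w ballot_sets_finite[OF S] by (auto elim: subset_interleaveE)
  have "v \<in> M" using assms u v by (auto simp: multicomplex_def)
  \<comment> \<open>Passing to a divisor lowers the degree and so enlarges the ground set, where T
    is still a ballot set.\<close>
  moreover have "T \<in> ballot_sets (d - 2 * size v)"
    using ballot_sets_subset[OF S T(1)] size_mset_mono[OF v] by simp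
  ultimately show "w' \<in> ballot_join d M" using T(2) by (auto simp: ballot_join_def)
qed

text \<open>By \<open>ballot_sets_extend\<close>, maximality forces card S to be the floor of (d - 2
  \<open>size u\<close>) / 2. The bound on \<open>size u\<close> keeps the subtraction from
  truncating.\<close>

lemma size_maximal_ballot_join:
  assumes "\<And>u. u \<in> M \<Longrightarrow> 2 * size u \<le> d" and "maximal_monomial (ballot_join d M) w"
  shows "size w = d div 2"
proof -
  obtain u S where u: "u \<in> M" and S: "S \<in> ballot_sets (d - 2 * size u)"
    and w: "w = interleave u S"
    using assms(2) by (auto simp: maximal_monomial_def ballot_join_def)
  have fin: "finite S" using S ballot_sets_finite by blast
  have "\<not> 2 * Suc (card S) \<le> d - 2 * size u"
  proof
    assume "2 * Suc (card S) \<le> d - 2 * size u"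
    then obtain x where x: "x \<notin> S" "insert x S \<in> ballot_sets (d - 2 * size u)"
      using ballot_sets_extend[OF S] by blast
    have "interleave u (insert x S) \<in> ballot_join d M" using u x by (auto simp: ballot_join_def)
    moreover have "w \<subseteq># interleave u (insert x S)" using x fin by (simp add: w interleave_def)
    ultimately have "interleave u (insert x S) = w"
      using assms(2) by (auto simp: maximal_monomial_def)
    then have "size (interleave u (insert x S)) = size w" by simp
    then show False using x fin by (simp add: w size_interleave)
  qed
  then show ?thesis
    using ballot_sets_card_le[OF S] assms(1)[OF u] by (simp add: w size_interleave)
qed

lemma f_number_ballot_join:
  assumes "finite M"
  shows "f_number i (ballot_join d M) =
    (\<Sum>j \<le> i. f_number j M * card {S \<in> ballot_sets (d - 2 * j). card S = i - j})"
proof -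
  \<comment> \<open>The pieces P j are disjoint because j is the degree of the first
    component.\<close>
  define P where "P j = {u \<in> M. size u = j} \<times> {S \<in> ballot_sets (d - 2 * j). card S = i - j}" for j
  have fin: "finite (P j)" for j using assms finite_ballot_sets by (simp add: P_def)
  have "{w \<in> ballot_join d M. size w = i} = case_prod interleave ` (\<Union>j \<le> i. P j)"
  proof (intro equalityI subsetI)
    fix w assume "w \<in> {w \<in> ballot_join d M. size w = i}"
    then obtain u S where u: "u \<in> M" and S: "S \<in> ballot_sets (d - 2 * size u)"
      and w: "w = interleave u S" and i: "size u + card S = i"
      by (auto simp: ballot_join_def size_interleave)
    have "(u, S) \<in> P (size u)" using u S i by (auto simp: P_def)
    then show "w \<in> case_prod interleave ` (\<Union>j \<le> i. P j)" using w i by force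
  qed (auto simp: P_def ballot_join_def size_interleave)
  moreover have "inj_on (case_prod interleave) (\<Union>j \<le> i. P j)"
  proof (rule inj_onI, clarify)
    fix u S j v T k
    assume "(u, S) \<in> P j" "(v, T) \<in> P k" and eq: "interleave u S = interleave v T"
    then have "finite S" "finite T" using ballot_sets_finite by (auto simp: P_def)
    then show "u = v \<and> S = T" using eq by (rule interleave_inject)
  qed
  ultimately have "f_number i (ballot_join d M) = card (\<Union>j \<le> i. P j)"
    by (simp add: f_number_def card_image)
  also have "\<dots> = (\<Sum>j \<le> i. card (P j))"
    using fin by (intro card_UN_disjoint) (auto simp: P_def)
  finally show ?thesis by (simp add: P_def card_cartesian_product f_number_def)
qed

section \<open>The g-vector in terms of the \<gamma>-vector\<close>

lemma coeff_one_plus_X_power: "coeff ([:1, 1:] ^ n :: int poly) i = int (n choose i)"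
  by (cases "i \<le> n") (auto simp: coeff_linear_poly_power coeff_eq_0 degree_linear_power)

text \<open>The factor t^j kills the summands with j > i, and i \<le> d div 2 ensures that every j
  \<le> i occurs in the expansion.\<close>

lemma coeff_gamma_expansion:
  assumes "i \<le> d div 2"
  shows "coeff (gamma_expansion d \<gamma>) i = (\<Sum>j \<le> i. \<gamma> ! j * int ((d - 2 * j) choose (i - j)))"
proof -
  have "coeff (gamma_expansion d \<gamma>) i =
      (\<Sum>j = 0..d div 2. if j \<le> i then \<gamma> ! j * int ((d - 2 * j) choose (i - j)) else 0)"
    unfolding gamma_expansion_def coeff_sum
    by (intro sum.cong) (auto simp: coeff_monom_mult coeff_one_plus_X_power)
  also have "\<dots> = (\<Sum>j \<le> i. \<gamma> ! j * int ((d - 2 * j) choose (i - j)))"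
    using assms by (intro sum.mono_neutral_cong_right) auto
  finally show ?thesis .
qed

lemma g_vector_nth_gamma:
  assumes "h = gamma_expansion (degree h) \<gamma>" "i \<le> degree h div 2"
  shows "g_vector h ! i =
    (\<Sum>j \<le> i. \<gamma> ! j * int (card {S \<in> ballot_sets (degree h - 2 * j). card S = i - j}))"
proof -
  define d where "d = degree h"
  have c: "coeff h k = (\<Sum>j \<le> k. \<gamma> ! j * int ((d - 2 * j) choose (k - j)))" if "k \<le> d div 2" for k
    using assms(1) coeff_gamma_expansion[OF that, of \<gamma>] by (simp add: d_def)
  have i: "i \<le> d div 2" using assms(2) by (simp add: d_def)
  have b: "int (card {S \<in> ballot_sets (d - 2 * j). card S = i - j}) =
      int ((d - 2 * j) choose (i - j)) - (if j = i then 0 else int ((d - 2 * j) choose (i - j - 1)))"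
    if "j \<le> i" for j
    using card_ballot_sets[of "i - j" "d - 2 * j"] that i by auto
  have "g_vector h ! i = coeff h i - (if i = 0 then 0 else coeff h (i - 1))"
    using assms(2) by (simp add: g_vector_def del: upt_Suc)
  \<comment> \<open>Padding with a zero term at j = i allows termwise subtraction; this zero matches
    the case k = 0 of \<open>card_ballot_sets\<close>.\<close>
  also have "(if i = 0 then 0 else coeff h (i - 1)) =
      (\<Sum>j \<le> i. \<gamma> ! j * (if j = i then 0 else int ((d - 2 * j) choose (i - j - 1))))"
    using i by (cases i) (auto simp: c intro!: sum.cong)
  also have "coeff h i - \<dots> =
      (\<Sum>j \<le> i. \<gamma> ! j * int (card {S \<in> ballot_sets (d - 2 * j). card S = i - j}))"
    unfolding c[OF i] sum_subtractf[symmetric]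
    by (intro sum.cong refl) (simp add: b right_diff_distrib)
  finally show ?thesis by (simp only: d_def)
qed

theorem theorem1p7:
  fixes h :: "int poly" and d :: nat
  assumes "h \<noteq> 0" and "degree h = d"
    and "\<forall>i \<le> d. coeff h i \<ge> 0"
    and "palindromic h"
    and "O_sequence (gamma_vector h)"
  shows "pure_O_sequence (g_vector h)"
proof -
  define \<gamma> where "\<gamma> = gamma_vector h"
  \<comment> \<open>Palindromicity gives existence and uniqueness, so the \<open>THE\<close> in
    \<open>gamma_vector\<close> denotes an actual expansion.\<close>
  have \<gamma>: "length \<gamma> = degree h div 2 + 1" "h = gamma_expansion (degree h) \<gamma>"
    using theI'[OF ex1_gamma_expansion[OF assms(4)]]
    by (simp_all add: \<gamma>_def gamma_vector_def)
  obtain M where M: "multicomplex M" "is_f_vector \<gamma> M"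
    using assms(5) by (auto simp: O_sequence_def \<gamma>_def)
  have fin: "finite M" using M(1) by (simp add: multicomplex_def)
  have f: "int (f_number j M) = \<gamma> ! j" if "j \<le> d div 2" for j
    using M(2) \<gamma>(1) assms(2) that by (simp add: is_f_vector_def)
  \<comment> \<open>The f-vector vanishes beyond the length of \<gamma>, so no monomial of M has
    degree above d div 2.\<close>
  have small: "2 * size u \<le> d" if "u \<in> M" for u
  proof (rule ccontr)
    assume "\<not> 2 * size u \<le> d"
    then have "f_number (size u) M = 0" using M(2) \<gamma>(1) assms(2) by (simp add: is_f_vector_def)
    then show False using that fin by (auto simp: f_number_def)
  qed
  have "pure_multicomplex (ballot_join d M)"
    using multicomplex_ballot_join[OF M(1)] size_maximal_ballot_join[of M d] small
    by (auto simp: pure_multicomplex_def)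
  moreover have "is_f_vector (g_vector h) (ballot_join d M)"
    unfolding is_f_vector_def
  proof (intro conjI allI impI)
    fix i assume "i < length (g_vector h)"
    then have i: "i \<le> d div 2" using assms(2) by (simp add: g_vector_def)
    then have "g_vector h ! i =
        (\<Sum>j \<le> i. \<gamma> ! j * int (card {S \<in> ballot_sets (d - 2 * j). card S = i - j}))"
      using g_vector_nth_gamma[OF \<gamma>(2)] assms(2) by simp
    then show "int (f_number i (ballot_join d M)) = g_vector h ! i"
      using i f by (simp add: f_number_ballot_join[OF fin])
  next
    fix i assume "length (g_vector h) \<le> i"
    then have i: "d div 2 < i" using assms(2) by (simp add: g_vector_def)
    \<comment> \<open>The ballot bound gives 2 \<open>size w\<close> \<le> 2 \<open>size u\<close> +
      (d - 2 \<open>size u\<close>) = d.\<close>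
    have "size w \<noteq> i" if w: "w \<in> ballot_join d M" for w
    proof -
      obtain u S where "u \<in> M" "S \<in> ballot_sets (d - 2 * size u)" "w = interleave u S"
        using w by (auto simp: ballot_join_def)
      then show ?thesis
        using i small[of u] ballot_sets_card_le[of S] by (fastforce simp: size_interleave)
    qed
    then have "{w \<in> ballot_join d M. size w = i} = {}" by blast
    then show "f_number i (ballot_join d M) = 0" unfolding f_number_def by (simp only: card.empty)
  qed
  ultimately show ?thesis by (auto simp: pure_O_sequence_def)
qed

end
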